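(* Let $(A,[,\ldots,],\alpha=(\alpha_1,\ldots,\alpha_{n-1}))$ be an $n$-ary Hom-Maltsev algebra over $\mathbf{k}$ with $n\ge 3$. Suppose $a_1,\ldots,a_k\in A$ with $k\le n-2$ satisfy $\alpha_{n-i}(a_i)=a_i$ for each $i\in\{1,\ldots,k\}$. Then $$A^k = (A,[,\ldots,]^{(k)},(\alpha_1,\ldots,\alpha_{n-k-1}))$$ is an $(n-k)$-ary Hom-Maltsev algebra, where $$[x_1,\ldots,x_{n-k}]^{(k)} = [x_1,\ldots,x_{n-k},a_k,a_{k-1},\ldots,a_1]$$ for all $x_1,\ldots,x_{n-k}\in A$. Moreover, if $A$ is multiplicative, then so is $A^k$.
   Context: $\mathbf{k}$ is a fixed field of characteristic $0$. For $n\ge 2$, an $n$-ary Hom-algebra $(A,[,\ldots,],\alpha=(\alpha_1,\ldots,\alpha_{n-1}))$ is a $\mathbf{k}$-module $A$ with an $n$-linear map $[,\ldots,]\colon A^{\otimes n}\to A$ and linear maps $\alpha_i\colon A\to A$ (the twisting maps). It is multiplicative if all the twisting maps are equal to one map $\alpha$ and $\alpha([x_1,\ldots,x_n])=[\alpha(x_1),\ldots,\alpha(x_n)]$. The product is anti-symmetric if $[x_1,\ldots,x_n]=\epsilon(\sigma)[x_{\sigma(1)},\ldots,x_{\sigma(n)}]$ for all permutations $\sigma$, with $\epsilon(\sigma)$ the sign. Abbreviations: $x_{i,j}$ stands for the sequence $x_i,\ldots,x_j$; $\alpha_{k,l}(x_{i,j})$ (with $l-k=j-i$) for $\alpha_k(x_i),\alpha_{k+1}(x_{i+1}),\ldots,\alpha_l(x_j)$;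 $\alpha^2_{k,l}(x_{i,j})$ for $\alpha_k^2(x_i),\ldots,\alpha_l^2(x_j)$; all are empty if $i>j$. The $n$-ary Hom-Maltsevian of $A$ is $$\begin{aligned} M^n_A(z;x_{2,n};y_{2,n}) &= \sum_{i=2}^n \alpha_1\big([[z,x_{2,n}],\alpha_{2,i-1}(x_{2,i-1}),[x_i,y_{2,n}],\alpha_{i,n-1}(x_{i+1,n})]\big)\\ &\quad+ \sum_{i=2}^n [[\alpha_1(z),\alpha_{2,i-1}(x_{2,i-1}),[x_i,y_{2,n}],\alpha_{i,n-1}(x_{i+1,n})],\alpha^2_{1,n-1}(x_{2,n})]\\ &\quad- [[[z,x_{2,n}],\alpha_{1,n-1}(x_{2,n})],\alpha^2_{1,n-1}(y_{2,n})] + [[[z,y_{2,n}],\alpha_{1,n-1}(x_{2,n})],\alpha^2_{1,n-1}(x_{2,n})]. \end{aligned}$$ An $n$-ary Hom-Maltsev algebra is an $n$-ary Hom-algebra $A$ whose product is anti-symmetric and for which $M^n_A(z;x_{2,n};y_{2,n})=0$ for all $z,x_j,y_k\in A$. *)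

theory Defs
  imports Complex_Main "HOL-Combinatorics.Combinatorics"
begin

text \<open>
  The underlying module of an \<open>n\<close>-ary Hom-algebra is a whole type, made into a vector space
  by \<open>scale\<close>. The product takes a list of arguments, and only its values on lists of length \<open>n\<close>
  matter. The twisting maps \<open>\<alpha> 1, \<dots>, \<alpha> (n - 1)\<close> are given by a family over \<open>nat\<close>; the
  values of \<open>\<alpha>\<close> at other indices are irrelevant.
\<close>

locale nary_hom_algebra = vector_space scale
  for scale :: "'k::field \<Rightarrow> 'a::ab_group_add \<Rightarrow> 'a" +
  fixes n :: nat
    and br :: "'a list \<Rightarrow> 'a"
    and \<alpha> :: "nat \<Rightarrow> 'a \<Rightarrow> 'a"
  assumes arity: "n \<ge> 2"
    and multilinear:
      "\<And>xs j. length xs = n \<Longrightarrow> j < n \<Longrightarrow>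
        Vector_Spaces.linear scale scale (\<lambda>x. br (xs[j := x]))"
    and twist_linear:
      "\<And>i. i \<in> {1..n - 1} \<Longrightarrow> Vector_Spaces.linear scale scale (\<alpha> i)"

definition multiplicative :: "nat \<Rightarrow> ('a list \<Rightarrow> 'a) \<Rightarrow> (nat \<Rightarrow> 'a \<Rightarrow> 'a) \<Rightarrow> bool" where
  "multiplicative n br \<alpha> \<longleftrightarrow>
    (\<exists>\<beta>. (\<forall>i\<in>{1..n - 1}. \<alpha> i = \<beta>) \<and>
         (\<forall>xs. length xs = n \<longrightarrow> \<beta> (br xs) = br (map \<beta> xs)))"

text \<open>
  List positions are counted from \<open>0\<close>, so permutations of \<open>{1, \<dots>, n}\<close> become
  permutations of \<open>{..<n}\<close>.
\<close>

definition antisymmetric ::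
    "('k::field \<Rightarrow> 'a \<Rightarrow> 'a) \<Rightarrow> nat \<Rightarrow> ('a list \<Rightarrow> 'a) \<Rightarrow> bool" where
  "antisymmetric scale n br \<longleftrightarrow>
    (\<forall>\<sigma> xs. \<sigma> permutes {..<n} \<longrightarrow> length xs = n \<longrightarrow>
      br xs = scale (of_int (sign \<sigma>)) (br (permute_list \<sigma> xs)))"

text \<open>
  \<open>seg x i j\<close> is the sequence \<open>x\<^sub>i, \<dots>, x\<^sub>j\<close>, and \<open>tseg p \<alpha> k x i j\<close> is
  \<open>\<alpha>\<^sub>k\<^sup>p(x\<^sub>i), \<alpha>\<^sub>k\<^sub>+\<^sub>1\<^sup>p(x\<^sub>i\<^sub>+\<^sub>1), \<dots>, \<alpha>\<^sub>l\<^sup>p(x\<^sub>j)\<close>, where \<open>l = k + j - i\<close>;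
  the exponent \<open>p\<close> is iteration. Both are empty if \<open>i > j\<close>.
\<close>

definition seg :: "(nat \<Rightarrow> 'a) \<Rightarrow> nat \<Rightarrow> nat \<Rightarrow> 'a list" where
  "seg x i j = map x [i..<Suc j]"

definition tseg ::
    "nat \<Rightarrow> (nat \<Rightarrow> 'a \<Rightarrow> 'a) \<Rightarrow> nat \<Rightarrow> (nat \<Rightarrow> 'a) \<Rightarrow> nat \<Rightarrow> nat \<Rightarrow> 'a list" where
  "tseg p \<alpha> k x i j = map (\<lambda>m. (\<alpha> (k + (m - i)) ^^ p) (x m)) [i..<Suc j]"

text \<open>
  The tuples \<open>x\<^sub>2, \<dots>, x\<^sub>n\<close> and \<open>y\<^sub>2, \<dots>, y\<^sub>n\<close> are given by functions on \<open>nat\<close>, of which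
  only the values at \<open>2, \<dots>, n\<close> enter.
\<close>

definition hom_maltsevian ::
    "nat \<Rightarrow> ('a::ab_group_add list \<Rightarrow> 'a) \<Rightarrow> (nat \<Rightarrow> 'a \<Rightarrow> 'a) \<Rightarrow>
      'a \<Rightarrow> (nat \<Rightarrow> 'a) \<Rightarrow> (nat \<Rightarrow> 'a) \<Rightarrow> 'a" where
  "hom_maltsevian n br \<alpha> z x y =
    (\<Sum>i = 2..n. \<alpha> 1 (br ([br (z # seg x 2 n)] @ tseg 1 \<alpha> 2 x 2 (i - 1)
        @ [br (x i # seg y 2 n)] @ tseg 1 \<alpha> i x (i + 1) n)))
    + (\<Sum>i = 2..n. br (br ([\<alpha> 1 z] @ tseg 1 \<alpha> 2 x 2 (i - 1)
        @ [br (x i # seg y 2 n)] @ tseg 1 \<alpha> i x (i + 1) n) # tseg 2 \<alpha> 1 x 2 n))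
    - br (br (br (z # seg x 2 n) # tseg 1 \<alpha> 1 x 2 n) # tseg 2 \<alpha> 1 y 2 n)
    + br (br (br (z # seg y 2 n) # tseg 1 \<alpha> 1 x 2 n) # tseg 2 \<alpha> 1 x 2 n)"

locale nary_hom_maltsev_algebra = nary_hom_algebra +
  assumes antisym: "antisymmetric scale n br"
    and hom_maltsev_identity: "\<And>z x y. hom_maltsevian n br \<alpha> z x y = 0"

text \<open>The product \<open>[x\<^sub>1, \<dots>, x\<^sub>n\<^sub>-\<^sub>k, a\<^sub>k, \<dots>, a\<^sub>1]\<close>.\<close>

definition reduced_br :: "('a list \<Rightarrow> 'a) \<Rightarrow> (nat \<Rightarrow> 'a) \<Rightarrow> nat \<Rightarrow> 'a list \<Rightarrow> 'a" where
  "reduced_br br a k xs = br (xs @ rev (seg a 1 k))"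

end

theory Submission
  imports Defs
begin

text \<open>
  The Hom-Maltsevian of the reduced algebra is a value of the Hom-Maltsevian of the original
  one. Write \<open>m = n - k\<close> and lengthen the tuples \<open>x\<^sub>2, \<dots>, x\<^sub>m\<close> and \<open>y\<^sub>2, \<dots>, y\<^sub>m\<close> to
  \<open>x\<^sub>2, \<dots>, x\<^sub>m, a\<^sub>k, \<dots>, a\<^sub>1\<close> and \<open>y\<^sub>2, \<dots>, y\<^sub>m, a\<^sub>k, \<dots>, a\<^sub>1\<close>. In the \<open>n\<close>-ary Hom-Maltsevian
  the entry in position \<open>p\<close> of either tuple only ever meets powers of \<open>\<alpha>\<^sub>p\<^sub>-\<^sub>1\<close>, except that it
  meets \<open>\<alpha>\<^sub>p\<close> to the left of the inserted bracket \<open>[x\<^sub>i, y\<^sub>2, \<dots>, y\<^sub>n]\<close>. The hypothesis on the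
  \<open>a\<^sub>j\<close> says precisely that \<open>\<alpha>\<^sub>p\<^sub>-\<^sub>1\<close> fixes the entry in position \<open>p > m\<close>, and the exception
  concerns such an entry only if \<open>i > m\<close>. Hence each summand with \<open>i \<le> m\<close> and each of the two
  terms outside the sums turns into the same term for the reduced product. The summands with
  \<open>i > m\<close> have no counterpart, but there the inserted bracket has the entry \<open>x\<^sub>i = y\<^sub>i\<close> twice, so
  it vanishes by anti-symmetry in characteristic \<open>0\<close>, and with it the summand, by multilinearity
  and linearity of \<open>\<alpha>\<^sub>1\<close>.

  These two halves are \<open>seg_splice\<close> and \<open>tseg_splice\<close> on the one hand, and
  \<open>antisymmetric_repeat_eq_0\<close> on the other; \<open>hom_maltsevian_splice\<close> puts them together. All
  \<open>k\<close> elements are absorbed at once, so that no induction on \<open>k\<close> occurs.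
\<close>

section \<open>Lengthening tuples\<close>

definition splice_at :: "nat \<Rightarrow> (nat \<Rightarrow> 'a) \<Rightarrow> (nat \<Rightarrow> 'a) \<Rightarrow> nat \<Rightarrow> 'a" where
  "splice_at m x c = (\<lambda>p. if p \<le> m then x p else c p)"

lemma upt_Suc_split: "i \<le> Suc m \<Longrightarrow> m \<le> n \<Longrightarrow> [i..<Suc n] = [i..<Suc m] @ [Suc m..<Suc n]"
  using upt_add_eq_append[of i "Suc m" "n - m"] by simp

lemma seg_splice:
  assumes "i \<le> Suc m" "m \<le> n"
  shows "seg (splice_at m x c) i n = seg x i m @ seg c (Suc m) n"
  unfolding seg_def upt_Suc_split[OF assms] by (simp add: splice_at_def del: upt_Suc)

lemma tseg_splice:
  assumes "t \<le> m" "m \<le> n"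
    and fixed: "\<And>p. p \<in> {Suc m..n} \<Longrightarrow> \<alpha> (p - 1) (c p) = c p"
  shows "tseg e \<alpha> t (splice_at m x c) (Suc t) n = tseg e \<alpha> t x (Suc t) m @ seg c (Suc m) n"
proof -
  have "(\<alpha> (p - 1) ^^ e) (c p) = c p" if "p \<in> {Suc m..n}" for p
    using fixed[OF that] by (induction e) auto
  moreover have "t + (p - Suc t) = p - 1" if "p \<in> {Suc m..n}" for p
    using that assms(1) by auto
  moreover have "Suc t \<le> Suc m" using assms(1) by simp
  ultimately show ?thesis
    unfolding tseg_def seg_def upt_Suc_split[OF \<open>Suc t \<le> Suc m\<close> assms(2)]
    by (simp add: splice_at_def del: upt_Suc)
qed

lemma tseg_splice_prefix:
  "j \<le> m \<Longrightarrow> tseg e \<alpha> t (splice_at m x c) i j = tseg e \<alpha> t x i j"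
  unfolding tseg_def by (simp add: splice_at_def del: upt_Suc)

lemma length_seg: "length (seg x i j) = Suc j - i"
  by (simp add: seg_def del: upt_Suc)

lemma length_tseg: "length (tseg e \<alpha> t x i j) = Suc j - i"
  by (simp add: tseg_def del: upt_Suc)

lemma rev_seg_eq_seg:
  assumes "k \<le> n"
  shows "rev (seg a 1 k) = seg (\<lambda>p. a (n + 1 - p)) (Suc (n - k)) n"
  using assms by (intro nth_equalityI) (auto simp: seg_def rev_nth nth_append Suc_diff_Suc simp del: upt_Suc)

section \<open>Vanishing products\<close>

text \<open>
  Exchanging the equal entries changes nothing but the sign, so twice the product is zero.
\<close>

lemma antisymmetric_repeat_eq_0:
  fixes scale :: "'k::field_char_0 \<Rightarrow> 'a::ab_group_add \<Rightarrow> 'a"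
  assumes "vector_space scale" and anti: "antisymmetric scale n br"
    and len: "length xs = n" and "i < n" "j < n" "i \<noteq> j" and eq: "xs ! i = xs ! j"
  shows "br xs = 0"
proof -
  interpret vector_space scale by fact
  let ?s = "Transposition.transpose i j"
  have perm: "?s permutes {..<n}"
    using \<open>i < n\<close> \<open>j < n\<close> by (intro permutes_swap_id) auto
  have "permute_list ?s xs = xs"
    using len eq by (intro nth_equalityI) (auto simp: permute_list_def transpose_def)
  then have "br xs = scale (of_int (sign ?s)) (br xs)"
    using anti perm len unfolding antisymmetric_def by metis
  then have "br xs + br xs = 0"
    using \<open>i \<noteq> j\<close> by (simp add: sign_swap_id eq_neg_iff_add_eq_0)
  then have "scale 2 (br xs) = 0"
    using scale_left_distrib[of 1 1 "br xs"] by simp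
  then show ?thesis by (simp add: scale_eq_0_iff)
qed

context nary_hom_algebra
begin

lemma br_zero_entry:
  assumes "length (us @ 0 # vs) = n"
  shows "br (us @ 0 # vs) = 0"
proof -
  have "Vector_Spaces.linear scale scale (\<lambda>x. br ((us @ 0 # vs)[length us := x]))"
    using assms by (intro multilinear) auto
  from module_hom.zero[OF this[folded module_hom_eq_linear]] show ?thesis by simp
qed

lemma twist_zero: "i \<in> {1..n - 1} \<Longrightarrow> \<alpha> i 0 = 0"
  using module_hom.zero[OF twist_linear[folded module_hom_eq_linear]] .

end

section \<open>The reduced algebra\<close>

text \<open>
  Fixing the last arguments of a product to the values \<open>c\<^sub>m\<^sub>+\<^sub>1, \<dots>, c\<^sub>n\<close> amounts to fixing the
  last entries of both tuples in the Hom-Maltsevian: a tail of twisted entries of the lengthened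
  tuple is the twisted tail of the short one followed by the \<open>c\<^sub>p\<close> themselves, and the summands
  with \<open>i > m\<close> vanish. The fixed values are numbered by their position here, so that
  \<open>c\<^sub>p = a\<^sub>n\<^sub>+\<^sub>1\<^sub>-\<^sub>p\<close> in the reduced algebra.
\<close>

lemma hom_maltsevian_splice:
  fixes scale :: "'k::field_char_0 \<Rightarrow> 'a::ab_group_add \<Rightarrow> 'a"
  assumes alg: "nary_hom_algebra scale n br \<alpha>" and anti: "antisymmetric scale n br"
    and m: "2 \<le> m" "m \<le> n"
    and fixed: "\<And>p. p \<in> {Suc m..n} \<Longrightarrow> \<alpha> (p - 1) (c p) = c p"
  shows "hom_maltsevian n br \<alpha> z (splice_at m x c) (splice_at m y c) =
    hom_maltsevian m (\<lambda>xs. br (xs @ seg c (Suc m) n)) \<alpha> z x y"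
proof -
  interpret nary_hom_algebra scale n br \<alpha> by fact
  let ?X = "splice_at m x c" and ?Y = "splice_at m y c"
  let ?br = "\<lambda>xs. br (xs @ seg c (Suc m) n)"
  \<comment> \<open>Arity and product are parameters, so that the summands of both Hom-Maltsevians are instances.\<close>
  define S where "S n br x y i =
    \<alpha> 1 (br ([br (z # seg x 2 n)] @ tseg 1 \<alpha> 2 x 2 (i - 1)
        @ [br (x i # seg y 2 n)] @ tseg 1 \<alpha> i x (i + 1) n))" for n br x y i
  define T where "T n br x y i =
    br (br ([\<alpha> 1 z] @ tseg 1 \<alpha> 2 x 2 (i - 1)
        @ [br (x i # seg y 2 n)] @ tseg 1 \<alpha> i x (i + 1) n) # tseg 2 \<alpha> 1 x 2 n)" for n br x y i
  have seg2: "seg (splice_at m w c) 2 n = seg w 2 m @ seg c (Suc m) n" for w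
    using m by (intro seg_splice) auto
  have tseg2: "tseg e \<alpha> 1 (splice_at m w c) 2 n = tseg e \<alpha> 1 w 2 m @ seg c (Suc m) n" for e w
    using tseg_splice[of 1 m n \<alpha> c e w, OF _ m(2) fixed] m(1) by (simp only: Suc_1)
  have same: "S n br ?X ?Y i = S m ?br x y i \<and> T n br ?X ?Y i = T m ?br x y i"
    if i: "i \<in> {2..m}" for i
  proof -
    have "tseg 1 \<alpha> i ?X (i + 1) n = tseg 1 \<alpha> i x (i + 1) m @ seg c (Suc m) n"
      using tseg_splice[of i m n \<alpha> c 1 x, OF _ m(2) fixed] i by simp
    moreover have "tseg 1 \<alpha> 2 ?X 2 (i - 1) = tseg 1 \<alpha> 2 x 2 (i - 1)"
      using i by (intro tseg_splice_prefix) auto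
    moreover have "?X i = x i" using i by (simp add: splice_at_def)
    ultimately show ?thesis by (simp add: S_def T_def seg2 tseg2[simplified])
  qed
  have vanish: "S n br ?X ?Y i = 0 \<and> T n br ?X ?Y i = 0" if i: "i \<in> {Suc m..n}" for i
  proof -
    have rep: "br (?X i # seg ?Y 2 n) = 0"
    proof (rule antisymmetric_repeat_eq_0[OF vector_space_axioms anti, where i = 0 and j = "i - 1"])
      \<comment> \<open>The list starts with \<open>?X i\<close> and \<open>?Y 2\<close>, so \<open>?Y i\<close> has index \<open>i - 1\<close>.\<close>
      show "(?X i # seg ?Y 2 n) ! 0 = (?X i # seg ?Y 2 n) ! (i - 1)"
      proof -
        obtain q where "i = 2 + q" using i m le_Suc_ex[of 2 i] by auto
        moreover from this have "q < length [2..<Suc n]" using i by auto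
        ultimately show ?thesis using i by (simp add: seg_def splice_at_def del: upt_Suc)
      qed
    qed (use i m in \<open>auto simp: length_seg\<close>)
    have inner: "br (u # tseg 1 \<alpha> 2 ?X 2 (i - 1) @ 0 # tseg 1 \<alpha> i ?X (i + 1) n) = 0" for u
      using br_zero_entry[of "u # tseg 1 \<alpha> 2 ?X 2 (i - 1)" "tseg 1 \<alpha> i ?X (i + 1) n"] i m
      by (auto simp: length_tseg)
    have outer: "br (0 # tseg 2 \<alpha> 1 ?X 2 n) = 0"
      using br_zero_entry[of "[]" "tseg 2 \<alpha> 1 ?X 2 n"] m by (simp add: length_tseg)
    have "\<alpha> 1 0 = 0" using twist_zero[of 1] m by simp
    then show ?thesis
      unfolding S_def T_def rep using inner outer by simp
  qed
  have sums: "(\<Sum>i = 2..n. S n br ?X ?Y i) = (\<Sum>i = 2..m. S m ?br x y i)"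
    "(\<Sum>i = 2..n. T n br ?X ?Y i) = (\<Sum>i = 2..m. T m ?br x y i)"
    using m same vanish by (intro sum.mono_neutral_cong_right; auto)+
  have expand: "hom_maltsevian n' br' \<alpha> z x' y' =
    (\<Sum>i = 2..n'. S n' br' x' y' i) + (\<Sum>i = 2..n'. T n' br' x' y' i)
    - br' (br' (br' (z # seg x' 2 n') # tseg 1 \<alpha> 1 x' 2 n') # tseg 2 \<alpha> 1 y' 2 n')
    + br' (br' (br' (z # seg y' 2 n') # tseg 1 \<alpha> 1 x' 2 n') # tseg 2 \<alpha> 1 x' 2 n')"
    for n' br' x' y'
    unfolding hom_maltsevian_def S_def T_def by (rule refl)
  show ?thesis
    unfolding expand sums by (simp add: seg2 tseg2[simplified])
qed

lemma antisymmetric_append: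
  fixes cs :: "'a list"
  assumes anti: "antisymmetric scale n br" and n: "n = m + length cs"
  shows "antisymmetric scale m (\<lambda>xs. br (xs @ cs))"
  unfolding antisymmetric_def
proof (intro allI impI)
  fix \<sigma> and xs :: "'a list"
  assume \<sigma>: "\<sigma> permutes {..<m}" and len: "length xs = m"
  have "\<sigma> permutes {..<n}"
    using \<sigma> by (rule permutes_subset) (use n in auto)
  moreover have "permute_list \<sigma> (xs @ cs) = permute_list \<sigma> xs @ cs"
  proof (rule nth_equalityI)
    fix i assume "i < length (permute_list \<sigma> (xs @ cs))"
    then show "permute_list \<sigma> (xs @ cs) ! i = (permute_list \<sigma> xs @ cs) ! i"
      using len permutes_in_image[OF \<sigma>, of i] permutes_not_in[OF \<sigma>, of i]
      by (cases "i < m") (auto simp: permute_list_def nth_append simp del: upt_Suc)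
  qed simp
  ultimately show "br (xs @ cs) = scale (of_int (sign \<sigma>)) (br (permute_list \<sigma> xs @ cs))"
    using anti len n unfolding antisymmetric_def by (metis length_append)
qed

lemma (in nary_hom_algebra) nary_hom_algebra_append:
  assumes "m \<ge> 2" and n: "n = m + length cs"
  shows "nary_hom_algebra scale m (\<lambda>xs. br (xs @ cs)) \<alpha>"
proof (intro nary_hom_algebra.intro nary_hom_algebra_axioms.intro vector_space_axioms)
  fix xs :: "'a list" and j
  assume "length xs = m" "j < m"
  then show "Vector_Spaces.linear scale scale (\<lambda>x. br (xs[j := x] @ cs))"
    using multilinear[of "xs @ cs" j] n by (simp add: list_update_append)
next
  fix i assume "i \<in> {1..m - 1}"
  then show "Vector_Spaces.linear scale scale (\<alpha> i)"
    using n by (intro twist_linear) auto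
qed (use assms in auto)

theorem theorem6p5:
  fixes scale :: "'k::field_char_0 \<Rightarrow> 'a::ab_group_add \<Rightarrow> 'a"
    and n k :: nat
    and br :: "'a list \<Rightarrow> 'a"
    and \<alpha> :: "nat \<Rightarrow> 'a \<Rightarrow> 'a"
    and a :: "nat \<Rightarrow> 'a"
  assumes "nary_hom_maltsev_algebra scale n br \<alpha>"
    and "n \<ge> 3"
    and "k \<le> n - 2"
    and "\<And>i. i \<in> {1..k} \<Longrightarrow> \<alpha> (n - i) (a i) = a i"
  shows "nary_hom_maltsev_algebra scale (n - k) (reduced_br br a k) \<alpha> \<and>
    (multiplicative n br \<alpha> \<longrightarrow> multiplicative (n - k) (reduced_br br a k) \<alpha>)"
proof -
  interpret nary_hom_maltsev_algebra scale n br \<alpha> by fact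
  define m where "m = n - k"
  define c where "c = (\<lambda>p. a (n + 1 - p))"
  define cs where "cs = seg c (Suc m) n"
  have m: "2 \<le> m" "m \<le> n" "n = m + k" using assms(2,3) by (auto simp: m_def)
  have cs: "cs = rev (seg a 1 k)"
    using rev_seg_eq_seg[of k n a] assms(3) by (simp add: cs_def c_def m_def)
  have red: "reduced_br br a k = (\<lambda>xs. br (xs @ cs))"
    by (simp add: reduced_br_def cs fun_eq_iff)
  have n: "n = m + length cs" using m by (simp add: cs length_seg)
  have fixed: "\<alpha> (p - 1) (c p) = c p" if "p \<in> {Suc m..n}" for p
  proof -
    have "n - (n + 1 - p) = p - 1" using that by auto
    moreover have "n + 1 - p \<in> {1..k}" using that m by auto
    ultimately show ?thesis using assms(4)[of "n + 1 - p"] by (simp add: c_def)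
  qed
  have "nary_hom_maltsev_algebra scale m (\<lambda>xs. br (xs @ cs)) \<alpha>"
  proof (intro nary_hom_maltsev_algebra.intro nary_hom_maltsev_algebra_axioms.intro)
    show "nary_hom_algebra scale m (\<lambda>xs. br (xs @ cs)) \<alpha>"
      using m(1) n by (rule nary_hom_algebra_append)
    show "antisymmetric scale m (\<lambda>xs. br (xs @ cs))"
      using antisym n by (rule antisymmetric_append)
    show "hom_maltsevian m (\<lambda>xs. br (xs @ cs)) \<alpha> z x y = 0" for z x y
      using hom_maltsevian_splice[OF nary_hom_algebra_axioms antisym m(1,2) fixed, where z = z and x = x and y = y]
        hom_maltsev_identity by (simp add: cs_def)
  qed
  moreover have "multiplicative m (\<lambda>xs. br (xs @ cs)) \<alpha>" if mult: "multiplicative n br \<alpha>"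
  proof -
    obtain \<beta> where \<beta>: "\<And>i. i \<in> {1..n - 1} \<Longrightarrow> \<alpha> i = \<beta>"
      and hom: "\<And>xs. length xs = n \<Longrightarrow> \<beta> (br xs) = br (map \<beta> xs)"
      using mult unfolding multiplicative_def by blast
    have "\<beta> (a i) = a i" if "i \<in> {1..k}" for i
    proof -
      have "n - i \<in> {1..n - 1}" using that m by auto
      then show ?thesis using assms(4)[OF that] \<beta> by metis
    qed
    then have "map \<beta> cs = cs"
      unfolding cs seg_def by (simp add: rev_map[symmetric] del: upt_Suc)
    then have "\<beta> (br (xs @ cs)) = br (map \<beta> xs @ cs)" if "length xs = m" for xs
      using hom[of "xs @ cs"] that n by simp
    moreover have "\<forall>i\<in>{1..m - 1}. \<alpha> i = \<beta>" using \<beta> m by auto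
    ultimately show ?thesis unfolding multiplicative_def by blast
  qed
  ultimately show ?thesis by (simp add: red m_def)
qed

end
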